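(* Let $F(\bm{X})=\frac12\|\bm{X}\|^2$, where $\|\cdot\|$ is the Frobenius norm. The corresponding total Bregman divergence of two matrices $\bm{X},\bm{Y}\in GL(N,\mathbb{F})$, called the total square loss (TSL), is given by $$\delta_F(\bm{X},\bm{Y})=\frac12\,\frac{\|\bm{X}-\bm{Y}\|^2}{\sqrt{1+\|\bm{Y}\|^2}}.$$
   Context: $\mathbb{F}$ is either $\mathbb{R}$ or $\mathbb{C}$, and $GL(N,\mathbb{F})$ is the general linear group of invertible $N\times N$ matrices over $\mathbb{F}$. The Frobenius inner product is $\langle \bm{X},\bm{Y}\rangle=\operatorname{tr}(\bm{X}^{\mathrm H}\bm{Y})$, where $\bm{X}^{\mathrm H}$ denotes the conjugate transpose of $\bm{X}$ in the complex case and the transpose in the real case, and $\|\bm{X}\|=\sqrt{\langle \bm{X},\bm{X}\rangle}$. The gradient $\nabla F$ associated with the Frobenius inner product is given by the Fréchet derivative: $\langle\nabla F(\bm{X}),\bm{Y}\rangle:=\frac{d}{d\varepsilon}\big|_{\varepsilon=0}F(\bm{X}+\varepsilon\bm{Y})$. For a strictly convex and differentiable function $F:GL(N,\mathbb{F})\to\mathbb{F}$, the total Bregman divergence (TBD) of $\bm{X},\bm{Y}\in GL(N,\mathbb{F})$ is $$\delta_F(\bm{X},\bm{Y})=\frac{F(\bm{X})-F(\bm{Y})-\langle \nabla F(\bm{Y}),\bm{X}-\bm{Y}\rangle}{\sqrt{1+\|\nabla F(\bm{Y})\|^2}}.$$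
   Formalization: In the complex case the pairings with the gradient, both in its definition and in the divergence, use Re tr(X^H Y) instead of tr(X^H Y), since otherwise the gradient of the real-valued F does not exist. *)

theory Defs
  imports "HOL-Analysis.Analysis"
begin

(* The scalar field is real or complex; the class carries the conjugation and
   the real part, so that both cases share the definitions below. *)
class real_or_complex = real_normed_field +
  fixes conj :: "'a \<Rightarrow> 'a"
    and real_part :: "'a \<Rightarrow> real"

instantiation real :: real_or_complex
begin
definition conj_real :: "real \<Rightarrow> real" where "conj_real x = x"
definition real_part_real :: "real \<Rightarrow> real" where "real_part_real x = x"
instance ..
end

instantiation complex :: real_or_complex
begin
definition conj_complex :: "complex \<Rightarrow> complex" where "conj_complex z = cnj z"
definition real_part_complex :: "complex \<Rightarrow> real" where "real_part_complex z = Re z"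
instance ..
end

definition GL :: "('a::real_or_complex ^ 'n ^ 'n) set" where
  "GL = {X. invertible X}"

definition conj_transpose :: "'a::real_or_complex ^ 'n ^ 'm \<Rightarrow> 'a ^ 'm ^ 'n" where
  "conj_transpose X = (\<chi> i j. conj (X $ j $ i))"

definition frob_inner :: "'a::real_or_complex ^ 'n ^ 'n \<Rightarrow> 'a ^ 'n ^ 'n \<Rightarrow> 'a" where
  "frob_inner X Y = trace (conj_transpose X ** Y)"

(* frob_inner X X is always real and nonnegative; real_part only adjusts its type. *)
definition frob_norm :: "'a::real_or_complex ^ 'n ^ 'n \<Rightarrow> real" where
  "frob_norm X = sqrt (real_part (frob_inner X X))"

(* F is real-valued, so in the complex case the directional derivative is real and
   only real-linear in the direction, and the pairing with the gradient has to be
   the real part of the Frobenius inner product. Over the reals, real_part is the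
   identity. *)
definition is_gradient ::
  "('a::real_or_complex ^ 'n ^ 'n \<Rightarrow> real) \<Rightarrow> 'a ^ 'n ^ 'n \<Rightarrow> 'a ^ 'n ^ 'n \<Rightarrow> bool" where
  "is_gradient F X G \<longleftrightarrow>
     (\<forall>Y. ((\<lambda>\<epsilon>::real. F (X + \<epsilon> *\<^sub>R Y)) has_real_derivative real_part (frob_inner G Y)) (at 0))"

definition gradient ::
  "('a::real_or_complex ^ 'n ^ 'n \<Rightarrow> real) \<Rightarrow> 'a ^ 'n ^ 'n \<Rightarrow> 'a ^ 'n ^ 'n" where
  "gradient F X = (THE G. is_gradient F X G)"

definition total_bregman ::
  "('a::real_or_complex ^ 'n ^ 'n \<Rightarrow> real) \<Rightarrow> 'a ^ 'n ^ 'n \<Rightarrow> 'a ^ 'n ^ 'n \<Rightarrow> real" where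
  "total_bregman F X Y =
     (F X - F Y - real_part (frob_inner (gradient F Y) (X - Y)))
       / sqrt (1 + (frob_norm (gradient F Y))\<^sup>2)"

(* The requirements on F under which total_bregman F is a divergence. GL is not
   convex, so the convexity inequality is required for the combinations lying in GL. *)
definition bregman_generator :: "('a::real_or_complex ^ 'n ^ 'n \<Rightarrow> real) \<Rightarrow> bool" where
  "bregman_generator F \<longleftrightarrow>
     (\<forall>X\<in>GL. F differentiable (at X)) \<and>
     (\<forall>X\<in>GL. \<forall>Y\<in>GL. \<forall>t::real. X \<noteq> Y \<longrightarrow> 0 < t \<longrightarrow> t < 1 \<longrightarrow>
        t *\<^sub>R X + (1 - t) *\<^sub>R Y \<in> GL \<longrightarrow>
        F (t *\<^sub>R X + (1 - t) *\<^sub>R Y) < t * F X + (1 - t) * F Y)"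

lemma real_part_frob_inner_real:
  fixes X Y :: "real ^ 'n ^ 'n"
  shows "real_part (frob_inner X Y) = X \<bullet> Y"
  unfolding frob_inner_def conj_transpose_def trace_def matrix_matrix_mult_def
    inner_vec_def real_part_real_def conj_real_def
  by (simp, rule sum.swap)

lemma real_part_frob_inner_complex:
  fixes X Y :: "complex ^ 'n ^ 'n"
  shows "real_part (frob_inner X Y) = X \<bullet> Y"
  unfolding frob_inner_def conj_transpose_def trace_def matrix_matrix_mult_def
    inner_vec_def real_part_complex_def conj_complex_def
  by (simp add: inner_complex_def Re_sum, rule sum.swap)

lemma half_norm_sq_strictly_convex:
  fixes X Y :: "'b::real_inner"
  assumes "X \<noteq> Y" "0 < t" "t < 1"
  shows "1/2 * (norm (t *\<^sub>R X + (1 - t) *\<^sub>R Y))\<^sup>2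
           < t * (1/2 * (norm X)\<^sup>2) + (1 - t) * (1/2 * (norm Y)\<^sup>2)"
proof -
  have "t * (1/2 * (norm X)\<^sup>2) + (1 - t) * (1/2 * (norm Y)\<^sup>2)
      - 1/2 * (norm (t *\<^sub>R X + (1 - t) *\<^sub>R Y))\<^sup>2 = t * (1 - t) / 2 * (norm (X - Y))\<^sup>2"
    unfolding power2_norm_eq_inner
    by (simp add: inner_add_left inner_add_right inner_diff_left inner_diff_right
        inner_commute[of Y X]) (simp add: field_simps power2_eq_square)
  moreover have "0 < t * (1 - t) / 2 * (norm (X - Y))\<^sup>2"
    using assms by simp
  ultimately show ?thesis by linarith
qed

lemma half_norm_sq_differentiable:
  "(\<lambda>X::'b::real_inner. 1/2 * (norm X)\<^sup>2) differentiable (at Z)"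
  unfolding power2_norm_eq_inner differentiable_def
  by (auto intro!: exI derivative_eq_intros)

lemma bregman_generator_half_sq_real:
  "bregman_generator (\<lambda>X::real ^ 'n ^ 'n. 1/2 * (frob_norm X)\<^sup>2)"
  unfolding bregman_generator_def frob_norm_def real_part_frob_inner_real
    norm_eq_sqrt_inner[symmetric]
  using half_norm_sq_strictly_convex half_norm_sq_differentiable by blast

lemma bregman_generator_half_sq_complex:
  "bregman_generator (\<lambda>X::complex ^ 'n ^ 'n. 1/2 * (frob_norm X)\<^sup>2)"
  unfolding bregman_generator_def frob_norm_def real_part_frob_inner_complex
    norm_eq_sqrt_inner[symmetric]
  using half_norm_sq_strictly_convex half_norm_sq_differentiable by blast

end

theory Submission
  imports Defs
begin

text \<open>Over both fields the real part of the Frobenius inner product is the Euclidean inner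
  product of the matrix space, so \<open>frob_norm\<close> is \<open>norm\<close> and the claim
  lives in a real inner product space. There half the squared norm has gradient \<open>Y\<close> at
  \<open>Y\<close> (\<open>gradient_half_norm_sq\<close>), which gives the denominator, and the
  numerator is the exact quadratic remainder of a Taylor expansion.\<close>

lemma gradient_half_norm_sq:
  fixes Y :: "'a::{real_or_complex, real_inner} ^ 'n ^ 'n"
  assumes ip: "\<And>A B :: 'a ^ 'n ^ 'n. real_part (frob_inner A B) = A \<bullet> B"
  shows "gradient (\<lambda>Z :: 'a ^ 'n ^ 'n. 1/2 * (norm Z)\<^sup>2) Y = Y"
proof -
  \<comment> \<open>Expanding the square gives a quadratic polynomial in \<epsilon> whose linear
    coefficient is \<open>Y \<bullet> D\<close>.\<close>
  have deriv: "((\<lambda>\<epsilon>::real. 1/2 * (norm (Y + \<epsilon> *\<^sub>R D))\<^sup>2) has_real_derivative Y \<bullet> D) (at 0)" for D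
    unfolding power2_norm_eq_inner inner_add_left inner_add_right inner_scaleR_left inner_scaleR_right
    by (auto intro!: derivative_eq_intros simp: inner_commute[of D Y])
  show ?thesis
    unfolding gradient_def is_gradient_def ip
  proof (rule the_equality)
    fix G :: "'a ^ 'n ^ 'n"
    assume "\<forall>D. ((\<lambda>\<epsilon>::real. 1/2 * (norm (Y + \<epsilon> *\<^sub>R D))\<^sup>2) has_real_derivative G \<bullet> D) (at 0)"
    with deriv have "G \<bullet> D = Y \<bullet> D" for D
      using DERIV_unique by blast
    \<comment> \<open>Test with the direction \<open>D = G - Y\<close>; definiteness then gives the
      uniqueness that \<open>THE\<close> demands.\<close>
    then have "(G - Y) \<bullet> (G - Y) = 0"
      by (simp add: inner_diff_left)
    then show "G = Y"
      by simp
  qed (use deriv in blast)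
qed

text \<open>The class \<open>real_or_complex\<close> has no axioms on \<open>conj\<close> and
  \<open>real_part\<close>; \<open>ip\<close> supplies what is needed of them, so one argument
  serves both fields.\<close>

lemma total_bregman_half_frob_norm_sq:
  fixes X Y :: "'a::{real_or_complex, real_inner} ^ 'n ^ 'n"
  assumes ip: "\<And>A B :: 'a ^ 'n ^ 'n. real_part (frob_inner A B) = A \<bullet> B"
  shows "total_bregman (\<lambda>Z. 1/2 * (frob_norm Z)\<^sup>2) X Y
    = 1/2 * ((frob_norm (X - Y))\<^sup>2 / sqrt (1 + (frob_norm Y)\<^sup>2))"
proof -
  have frob_norm: "frob_norm Z = norm Z" for Z :: "'a ^ 'n ^ 'n"
    by (simp add: frob_norm_def ip norm_eq_sqrt_inner)
  \<comment> \<open>Expand \<open>X = Y + (X - Y)\<close>: subtracting the value and the linear term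
    at \<open>Y\<close> leaves only the square of the increment.\<close>
  have "1/2 * (norm X)\<^sup>2 - 1/2 * (norm Y)\<^sup>2 - Y \<bullet> (X - Y) = 1/2 * (norm (X - Y))\<^sup>2"
    unfolding power2_norm_eq_inner
    by (simp add: inner_diff_left inner_diff_right inner_commute[of Y X] field_simps)
  then show ?thesis
    unfolding total_bregman_def frob_norm gradient_half_norm_sq[OF ip] ip by (simp only: times_divide_eq_right)
qed

theorem proposition2:
  shows "(\<forall>X \<in> (GL :: (real ^ 'n ^ 'n) set). \<forall>Y \<in> GL.
            total_bregman (\<lambda>Z. 1/2 * (frob_norm Z)\<^sup>2) X Y
              = 1/2 * ((frob_norm (X - Y))\<^sup>2 / sqrt (1 + (frob_norm Y)\<^sup>2))) \<and>
         (\<forall>X \<in> (GL :: (complex ^ 'n ^ 'n) set). \<forall>Y \<in> GL.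
            total_bregman (\<lambda>Z. 1/2 * (frob_norm Z)\<^sup>2) X Y
              = 1/2 * ((frob_norm (X - Y))\<^sup>2 / sqrt (1 + (frob_norm Y)\<^sup>2)))"
  \<comment> \<open>The two \<open>real_part_frob_inner\<close> lemmas discharge \<open>ip\<close>
    for the respective field.\<close>
  by (intro conjI ballI total_bregman_half_frob_norm_sq
      real_part_frob_inner_real real_part_frob_inner_complex)

end
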